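(* Let $\alpha \in \mathbb{T} = \mathbb{R}/\mathbb{Z}$ be irrational, let $\Omega = \mathbb{T} \times \mathbb{Z}_2$ carry the product probability measure $\mu$ of Lebesgue measure on $\mathbb{T}$ and the uniform measure on $\mathbb{Z}_2$, and let $T : \Omega \to \Omega$, $T(\theta,j) = (\theta + \alpha, j+1)$. Let $\varepsilon \in (0,1)$ and $k \in \mathbb{Z} \setminus \{0\}$, and define $f : \Omega \to \mathbb{D}$ by $$ f(\theta,j) = \begin{cases} (1 - \varepsilon^2)^{1/2} e^{2 \pi i k \theta} & j = 0, \\ (1 - \varepsilon^2)^{1/2} e^{- 2 \pi i k \theta} & j = 1. \end{cases} $$ For $z \in \partial \mathbb{D}$, let $\gamma(z)$ be the Lyapunov exponent of the Szegő cocycle $A^z$ over $T$ associated with $f$. Then $$ \inf_{z \in \partial \mathbb{D}} \gamma(z) \ge \log \frac{(1 - \varepsilon^2)^{1/2}}{\varepsilon}. $$ In particular, if $\varepsilon \in (0, \frac{1}{\sqrt{2}})$, then the Lyapunov exponent $\gamma(\cdot)$ is uniformly positive on $\partial \mathbb{D}$, that is, $\inf_{z \in \partial \mathbb{D}} \gamma(z) > 0$.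
   Context: $\mathbb{D}$ is the open unit disk in $\mathbb{C}$ and $\partial \mathbb{D}$ is the unit circle. $\mathbb{Z}_2 = \{0,1\}$ is the group with two elements, with each element given probability $\frac12$. The transformation $T$ is ergodic with respect to $\mu$. Szegő cocycle: for a measurable $f : \Omega \to \mathbb{D}$ with $\int_\Omega \log(1 - |f|)\, d\mu > -\infty$ and $z \in \partial \mathbb{D}$, define $$ A^z(\omega) = (1 - |f(\omega)|^2)^{-1/2} \begin{pmatrix} z & - \overline{f(\omega)} \\ - f(\omega) z & 1 \end{pmatrix}, \qquad \omega \in \Omega, $$ and $A^z_n(\omega) = A^z(T^{n-1}\omega) \cdots A^z(T\omega) A^z(\omega)$ for $n \ge 1$. Lyapunov exponent: $$ \gamma(z) = \lim_{n \to \infty} \frac1n \int_\Omega \log \| A^z_n(\omega) \| \, d\mu(\omega), $$ where $\|\cdot\|$ is the operator norm on $2 \times 2$ complex matrices; the limit exists by subadditivity (Kingman's theorem). *)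

theory Defs
  imports "HOL-Analysis.Analysis" "HOL-Library.Z2"
begin

text \<open>The $L^2$ operator norm: \<^typ>\<open>complex^2\<close> carries the Euclidean norm, and the supremum
  defining \<^const>\<open>onorm\<close> ranges over all of \<^typ>\<open>complex^2\<close>.\<close>

definition mat_norm :: "complex^2^2 \<Rightarrow> real" where
  "mat_norm A = onorm (\<lambda>v. A *v v)"

definition szego_matrix :: "('a \<Rightarrow> complex) \<Rightarrow> complex \<Rightarrow> 'a \<Rightarrow> complex^2^2" where
  "szego_matrix f z \<omega> =
     (let c = complex_of_real (1 / sqrt (1 - (cmod (f \<omega>))\<^sup>2))
      in vector [vector [c * z,             c * (- cnj (f \<omega>))],
                 vector [c * (- f \<omega> * z), c * 1]])"

primrec cocycle_iterate ::
  "('a \<Rightarrow> complex^2^2) \<Rightarrow> ('a \<Rightarrow> 'a) \<Rightarrow> nat \<Rightarrow> 'a \<Rightarrow> complex^2^2" where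
  "cocycle_iterate A T 0 \<omega> = mat 1"
| "cocycle_iterate A T (Suc n) \<omega> = A ((T ^^ n) \<omega>) ** cocycle_iterate A T n \<omega>"

definition lyapunov_exponent ::
  "'a measure \<Rightarrow> ('a \<Rightarrow> 'a) \<Rightarrow> ('a \<Rightarrow> complex^2^2) \<Rightarrow> real" where
  "lyapunov_exponent M T A =
     lim (\<lambda>n. (1 / real n) * (\<integral>\<omega>. ln (mat_norm (cocycle_iterate A T n \<omega>)) \<partial>M))"

text \<open>The circle $R/Z$ is represented by its fundamental domain $[0,1)$, with addition
  reduced modulo 1 by \<^const>\<open>frac\<close>; the two-element group is \<^typ>\<open>bit\<close>.\<close>

definition Omega_measure :: "(real \<times> bit) measure" where
  "Omega_measure = restrict_space lborel {0..<1} \<Otimes>\<^sub>M uniform_count_measure {0, 1}"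

definition rotation_flip :: "real \<Rightarrow> real \<times> bit \<Rightarrow> real \<times> bit" where
  "rotation_flip \<alpha> = (\<lambda>(\<theta>, j). (frac (\<theta> + \<alpha>), j + 1))"

definition verblunsky_fun :: "real \<Rightarrow> int \<Rightarrow> real \<times> bit \<Rightarrow> complex" where
  "verblunsky_fun \<epsilon> k = (\<lambda>(\<theta>, j).
     if j = 0 then complex_of_real (sqrt (1 - \<epsilon>\<^sup>2)) * exp (2 * pi * \<i> * of_int k * of_real \<theta>)
     else complex_of_real (sqrt (1 - \<epsilon>\<^sup>2)) * exp (- (2 * pi * \<i> * of_int k * of_real \<theta>)))"

definition szego_lyapunov :: "real \<Rightarrow> real \<Rightarrow> int \<Rightarrow> complex \<Rightarrow> real" where
  "szego_lyapunov \<alpha> \<epsilon> k z =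
     lyapunov_exponent Omega_measure (rotation_flip \<alpha>) (szego_matrix (verblunsky_fun \<epsilon> k) z)"

end

theory Submission
  imports Defs "HOL-Complex_Analysis.Complex_Analysis"
    "HOL-Computational_Algebra.Fundamental_Theorem_Algebra"
begin

text \<open>
  This is Herman's subharmonicity argument. Put $w = e^{2 \pi i k \theta}$ on the fibre $j = 0$ and
  $w = e^{-2 \pi i k \theta}$ on the fibre $j = 1$. Along an orbit $f$ is alternately a unimodular
  multiple of $(1 - \varepsilon^2)^{1/2} w$ and of $(1 - \varepsilon^2)^{1/2} w^{-1}$, so $w^2$ times a
  two-step transfer matrix is a polynomial in $w$ whose value at $w = 0$ has only the lower right entry
  nonzero, of modulus $(1 - \varepsilon^2) / \varepsilon^2$. Hence $w^{2n}$ times the lower right entry of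
  the $2n$-step matrix is a polynomial in $w$ with constant term of modulus
  $((1 - \varepsilon^2)^{1/2} / \varepsilon)^{2n}$, and Jensen's inequality bounds the mean of the logarithm
  of the norm from below.

  The logarithm of the norm is continuous and nonnegative, so Jensen's inequality can be obtained without
  integrating logarithmic singularities: reflect the zeros inside the disk across the circle and apply
  the mean value property to a holomorphic logarithm on circles of radius less than 1.
\<close>

subsection \<open>Jensen's inequality\<close>

text \<open>Cauchy's integral formula at the centre: the kernel \<open>1 / w\<close> cancels against
  the derivative of the circle path, up to the constant \<open>2 * pi * \<i>\<close>.\<close>

lemma mean_value_holomorphic:
  fixes h :: "complex \<Rightarrow> complex" and r R :: real
  assumes "h holomorphic_on ball 0 R" "0 < r" "r < R"
  shows "((\<lambda>t. h (r * exp (2 * of_real pi * \<i> * of_real t))) has_integral h 0) {0..1}"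
proof -
  have sub: "cball 0 r \<subseteq> ball (0::complex) R"
    using assms by auto
  have "((\<lambda>u. h u / (u - 0)) has_contour_integral 2 * of_real pi * \<i> * h 0) (circlepath 0 r)"
  proof (rule Cauchy_integral_circlepath)
    show "continuous_on (cball 0 r) h"
      using assms(1) sub holomorphic_on_imp_continuous_on holomorphic_on_subset by blast
    show "h holomorphic_on ball 0 r"
      using assms(1) sub by (meson ball_subset_cball holomorphic_on_subset)
  qed (use assms in auto)
  note circle_integral = this
  have circ: "circlepath 0 r t = r * exp (2 * of_real pi * \<i> * of_real t)" for t
    by (simp add: circlepath mult_ac)
  from circle_integral have "((\<lambda>t. h (r * exp (2 * of_real pi * \<i> * of_real t)) / (r * exp (2 * of_real pi * \<i> * of_real t))
      * (2 * pi * \<i> * r * exp (2 * of_real pi * \<i> * of_real t))) has_integral 2 * of_real pi * \<i> * h 0) {0..1}"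
    unfolding has_contour_integral_def
    by (rule has_integral_eq[rotated]) (auto simp: vector_derivative_circlepath01 circ)
  from has_integral_mult_right[OF this, of "1 / (2 * of_real pi * \<i>)"] show ?thesis
    using assms(2) by (simp add: field_simps)
qed

text \<open>On the unit circle \<open>cnj w\<close> is the inverse of \<open>w\<close>, so
  \<open>1 - cnj r * w\<close> equals \<open>w * cnj (w - r)\<close>. Hence a zero can be reflected
  across the circle without changing the modulus there.\<close>

lemma cmod_reflected_factor:
  assumes "cmod w = 1"
  shows "cmod (1 - cnj r * w) = cmod (w - r)"
proof -
  have "w * cnj w = 1"
    using assms by (simp add: complex_norm_square[symmetric])
  then have "w * cnj (w - r) = 1 - cnj r * w"
    by (simp add: algebra_simps)
  then show ?thesis
    by (metis assms complex_mod_cnj mult_1 norm_mult)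
qed

text \<open>By induction on the degree, each factor \<open>w - r\<close> with
  \<open>cmod r < 1\<close> is traded for \<open>1 - cnj r * w\<close>, whose modulus at 0 is 1
  instead of \<open>cmod r\<close>. All other factors are kept, so zeros on the circle itself may
  survive.\<close>

lemma zero_free_replacement:
  fixes p :: "complex poly"
  assumes "poly p 0 \<noteq> 0"
  obtains q where "\<And>w. cmod w < 1 \<Longrightarrow> poly q w \<noteq> 0"
    "\<And>w. cmod w = 1 \<Longrightarrow> cmod (poly q w) = cmod (poly p w)"
    "cmod (poly p 0) \<le> cmod (poly q 0)"
proof -
  have "\<exists>q. (\<forall>w. cmod w < 1 \<longrightarrow> poly q w \<noteq> 0) \<and>
    (\<forall>w. cmod w = 1 \<longrightarrow> cmod (poly q w) = cmod (poly p w)) \<and> cmod (poly p 0) \<le> cmod (poly q 0)"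
    using assms
  proof (induction "degree p" arbitrary: p)
    case 0
    then obtain c where "p = [:c:]"
      by (metis degree_eq_zeroE)
    then show ?case
      using 0 by (intro exI[of _ p]) auto
  next
    case (Suc n)
    then have "\<not> constant (poly p)"
      by (simp add: constant_degree)
    then obtain r where r: "poly p r = 0"
      using fundamental_theorem_of_algebra by blast
    then obtain p1 where p1: "p = [:- r, 1:] * p1"
      by (metis dvdE poly_eq_0_iff_dvd)
    then have "p1 \<noteq> 0" "poly p1 0 \<noteq> 0" "r \<noteq> 0"
      using Suc.prems by auto
    moreover have "n = degree p1"
      using Suc.hyps(2) p1 \<open>p1 \<noteq> 0\<close> by (simp add: degree_mult_eq del: mult_pCons_left)
    ultimately obtain q1 where q1: "\<And>w. cmod w < 1 \<Longrightarrow> poly q1 w \<noteq> 0"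
      "\<And>w. cmod w = 1 \<Longrightarrow> cmod (poly q1 w) = cmod (poly p1 w)"
      "cmod (poly p1 0) \<le> cmod (poly q1 0)"
      using Suc.hyps(1) by blast
    show ?case
    proof (cases "cmod r < 1")
      case True
      have "cnj r * w \<noteq> 1" if "cmod w < 1" for w
      proof
        assume "cnj r * w = 1"
        then have "cmod r * cmod w = 1"
          by (metis complex_mod_cnj norm_mult norm_one)
        moreover have "cmod r * cmod w < 1 * 1"
          using True that by (intro mult_strict_mono') auto
        ultimately show False by simp
      qed
      moreover have "cmod r * cmod (poly p1 0) \<le> 1 * cmod (poly q1 0)"
        using True q1(3) by (intro mult_mono) auto
      moreover have "poly ([:1, - cnj r:] * q1) w = (1 - cnj r * w) * poly q1 w"
        "poly p w = (w - r) * poly p1 w" for w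
        by (simp_all add: p1 algebra_simps)
      ultimately show ?thesis
        using q1 cmod_reflected_factor[of _ r]
        by (intro exI[of _ "[:1, - cnj r:] * q1"]) (simp add: norm_mult)
    next
      case False
      have "poly ([:- r, 1:] * q) w = (w - r) * poly q w" for q w
        by (simp add: algebra_simps)
      with False show ?thesis
        using q1 by (intro exI[of _ "[:- r, 1:] * q1"]) (auto simp: p1 norm_mult mult_left_mono simp del: mult_pCons_left)
    qed
  qed
  then show ?thesis
    using that by blast
qed

text \<open>A continuous majorant \<open>g\<close> stands in for the logarithm of the modulus of
  \<open>p\<close>, which may be singular on the circle. The mean value property is applied to a
  logarithm of the zero-free \<open>q\<close> on a slightly smaller circle, at the cost of an error
  \<delta>.\<close>

lemma jensen_unit_frequency:
  fixes p :: "complex poly" and g :: "real \<Rightarrow> real"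
  assumes p0: "poly p 0 \<noteq> 0" and g: "continuous_on {0..1} g"
    and g0: "\<And>t. t \<in> {0..1} \<Longrightarrow> 0 \<le> g t"
    and le: "\<And>t. t \<in> {0..1} \<Longrightarrow> cmod (poly p (exp (2 * of_real pi * \<i> * of_real t))) \<le> exp (g t)"
  shows "ln (cmod (poly p 0)) \<le> integral {0..1} g"
proof -
  define e where "e = (\<lambda>t::real. exp (2 * of_real pi * \<i> * of_real t))"
  have norm_e [simp]: "cmod (e t) = 1" for t
    by (simp add: e_def)
  obtain q where q: "\<And>w. cmod w < 1 \<Longrightarrow> poly q w \<noteq> 0"
    "\<And>w. cmod w = 1 \<Longrightarrow> cmod (poly q w) = cmod (poly p w)"
    "cmod (poly p 0) \<le> cmod (poly q 0)"
    using zero_free_replacement[OF p0] by blast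
  have "ln (cmod (poly p 0)) \<le> integral {0..1} g + \<delta>" if "\<delta> > 0" for \<delta>
  proof -
    have uc: "uniformly_continuous_on (cball 0 1) (poly q)"
      by (rule compact_uniformly_continuous) (auto intro: continuous_on_poly continuous_on_id)
    obtain \<eta> where \<eta>: "\<eta> > 0" "\<And>x y. x \<in> cball 0 1 \<Longrightarrow> y \<in> cball 0 1 \<Longrightarrow> dist y x < \<eta> \<Longrightarrow>
        dist (poly q y) (poly q x) < \<delta>"
      using uc \<open>\<delta> > 0\<close> unfolding uniformly_continuous_on_def by meson
    \<comment> \<open>The term \<open>1 - \<eta> / 2\<close> brings the circle within \<eta> of the
      unit circle; the maximum with \<open>1 / 2\<close> keeps the radius positive when \<eta> is
      large.\<close>
    define r where "r = max (1 / 2) (1 - \<eta> / 2)"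
    have r: "0 < r" "r < 1" "1 - r < \<eta>"
      using \<eta>(1) by (auto simp: r_def)
    obtain L where L: "L holomorphic_on ball 0 1" "\<And>w. w \<in> ball 0 1 \<Longrightarrow> poly q w = exp (L w)"
    proof (rule contractible_imp_holomorphic_log)
      show "poly q holomorphic_on ball 0 1"
        by (intro holomorphic_intros)
      show "contractible (ball (0::complex) 1)"
        by (simp add: convex_imp_contractible)
    qed (use q(1) in auto)
    have lnL: "ln (cmod (poly q w)) = Re (L w)" if "w \<in> ball 0 1" for w
      using L(2)[OF that] by simp
    have mv: "((\<lambda>t. Re (L (r * e t))) has_integral Re (L 0)) {0..1}"
      using has_integral_Re[OF mean_value_holomorphic[OF L(1) r(1,2)]] by (simp add: e_def)
    have "Re (L 0) \<le> integral {0..1} (\<lambda>t. g t + \<delta>)"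
    proof (rule has_integral_le[OF mv])
      show "((\<lambda>t. g t + \<delta>) has_integral integral {0..1} (\<lambda>t. g t + \<delta>)) {0..1}"
        by (intro integrable_integral integrable_continuous_real continuous_intros g)
      fix t :: real assume t: "t \<in> {0..1}"
      have in1: "r * e t \<in> ball 0 1"
        using r by (simp add: norm_mult)
      have "dist (r * e t) (e t) = cmod (of_real (r - 1) * e t)"
        by (simp add: dist_norm algebra_simps)
      also have "\<dots> = 1 - r"
        using r by (simp add: norm_mult del: of_real_diff)
      finally have "dist (poly q (r * e t)) (poly q (e t)) < \<delta>"
        using \<eta>(2)[of "e t" "r * e t"] r in1 by (simp add: norm_mult)
      then have "cmod (poly q (r * e t)) \<le> cmod (poly q (e t)) + \<delta>"
        using norm_triangle_ineq2[of "poly q (r * e t)" "poly q (e t)"] by (simp add: dist_norm)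
      also have "\<dots> \<le> exp (g t) + \<delta>"
        using le[OF t] q(2)[of "e t"] by (simp add: e_def)
      \<comment> \<open>Since \<open>g t\<close> is nonnegative, \<open>exp (g t)\<close> is at
        least 1. This turns the additive error \<delta> into a factor \<open>1 + \<delta>\<close>,
        hence into an additive error after taking logarithms.\<close>
      also have "\<dots> \<le> exp (g t) * (1 + \<delta>)"
        using g0[OF t] that by (simp add: algebra_simps)
      also have "\<dots> \<le> exp (g t) * exp \<delta>"
        by (intro mult_left_mono exp_ge_add_one_self) auto
      finally have "exp (Re (L (r * e t))) \<le> exp (g t + \<delta>)"
        using L(2)[OF in1] by (simp add: exp_add)
      then show "Re (L (r * e t)) \<le> g t + \<delta>"
        by simp
    qed
    also have "\<dots> = integral {0..1} g + \<delta>"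
      using integrable_continuous_real[OF g] by (subst integral_add) auto
    finally have "ln (cmod (poly q 0)) \<le> integral {0..1} g + \<delta>"
      using lnL[of 0] by simp
    moreover have "ln (cmod (poly p 0)) \<le> ln (cmod (poly q 0))"
      using p0 q(3) by (intro ln_mono) auto
    ultimately show ?thesis by simp
  qed
  then show ?thesis
    by (rule field_le_epsilon)
qed

text \<open>Substituting the power \<open>\<bar>k\<bar>\<close> of the variable reduces to frequency
  1. For negative \<open>k\<close> the coefficients are conjugated as well, which conjugates both
  the argument and the value; the modulus of the constant term is unaffected.\<close>

lemma jensen_frequency:
  fixes p :: "complex poly" and g :: "real \<Rightarrow> real" and k :: int
  assumes "k \<noteq> 0" and p0: "poly p 0 \<noteq> 0" and g: "continuous_on {0..1} g"
    and g0: "\<And>t. t \<in> {0..1} \<Longrightarrow> 0 \<le> g t"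
    and le: "\<And>t. t \<in> {0..1} \<Longrightarrow> cmod (poly p (exp (2 * pi * \<i> * of_int k * of_real t))) \<le> exp (g t)"
  shows "ln (cmod (poly p 0)) \<le> integral {0..1} g"
proof -
  define m where "m = nat \<bar>k\<bar>"
  have m: "m > 0" and k: "k = int m \<or> k = - int m"
    using \<open>k \<noteq> 0\<close> by (auto simp: m_def)
  define p' where "p' = (if k > 0 then p else map_poly cnj p)"
  define P where "P = pcompose p' (monom 1 m)"
  have P0: "cmod (poly P 0) = cmod (poly p 0)"
    using m by (simp add: P_def p'_def poly_pcompose poly_monom power_0_left)
  have "cmod (poly P (exp (2 * of_real pi * \<i> * of_real t)))
      = cmod (poly p (exp (2 * pi * \<i> * of_int k * of_real t)))" for t
  proof -
    have 1: "exp (2 * of_real pi * \<i> * of_real t) ^ m = exp (2 * pi * \<i> * of_nat m * of_real t)"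
      by (simp add: exp_of_nat_mult[symmetric] mult_ac)
    have 2: "cnj (exp (2 * pi * \<i> * of_nat m * of_real t)) = exp (2 * pi * \<i> * of_int (- int m) * of_real t)"
      by (simp add: exp_cnj)
    from k m consider "k = int m" "k > 0" | "k = - int m" "\<not> k > 0" by linarith
    then show ?thesis
    proof cases
      case 1
      then show ?thesis using \<open>exp _ ^ m = _\<close> by (simp add: P_def p'_def poly_pcompose poly_monom)
    next
      case 2
      then show ?thesis using \<open>exp _ ^ m = _\<close> \<open>cnj _ = _\<close>
        by (simp only: P_def p'_def poly_pcompose poly_monom if_False poly_map_poly_cnj complex_mod_cnj mult_1)
    qed
  qed
  then have "ln (cmod (poly P 0)) \<le> integral {0..1} g"
    using p0 P0 by (intro jensen_unit_frequency g g0) (use le in auto)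
  then show ?thesis
    by (simp only: P0)
qed

subsection \<open>Subadditive sequences, matrix norms and integrals\<close>

text \<open>Fekete's lemma, by division with remainder by a nearly optimal \<open>m\<close>. The
  infimum starts at 1 because the quotient at index 0 is 0 by convention.\<close>

lemma fekete_nonneg:
  fixes a :: "nat \<Rightarrow> real"
  assumes sub: "\<And>m n. a (m + n) \<le> a m + a n" and nonneg: "\<And>n. 0 \<le> a n"
  shows "(\<lambda>n. a n / real n) \<longlonglongrightarrow> (INF n\<in>{1..}. a n / real n)"
proof -
  define L where "L = (INF n\<in>{1..}. a n / real n)"
  have bdd: "bdd_below ((\<lambda>n. a n / real n) ` {1..})"
    using nonneg by (intro bdd_belowI[of _ 0]) auto
  have lower: "L \<le> a n / real n" if "n \<ge> 1" for n
    unfolding L_def using that by (intro cINF_lower bdd) auto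
  have mult: "a (q * m + r) \<le> real q * a m + a r" for q m r
  proof (induction q)
    case (Suc q)
    then show ?case
      using sub[of m "q * m + r"] by (simp add: algebra_simps)
  qed simp
  show ?thesis
    unfolding L_def[symmetric]
  proof (rule LIMSEQ_I)
    fix e :: real assume "e > 0"
    then have "L < L + e / 2" by simp
    then obtain m where m: "m \<ge> 1" "a m / real m < L + e / 2"
      unfolding L_def by (subst (asm) cINF_less_iff[OF _ bdd]) auto
    \<comment> \<open>A bound for every remainder term \<open>a (n mod m)\<close> that does not
      depend on \<open>n\<close>.\<close>
    define C where "C = (\<Sum>r<m. a r)"
    have C: "a r \<le> C" if "r < m" for r
      unfolding C_def using that nonneg by (intro member_le_sum) auto
    have "C \<ge> 0"
      using nonneg by (simp add: C_def sum_nonneg)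
    obtain N where N: "real N > 2 * C / e"
      using reals_Archimedean2 by blast
    show "\<exists>no. \<forall>n\<ge>no. norm (a n / real n - L) < e"
    proof (intro exI[of _ "max N 1"] allI impI)
      fix n assume n: "n \<ge> max N 1"
      have "real (n div m) * a m = real (n div m * m) * (a m / real m)"
        using m by simp
      also have "\<dots> \<le> real n * (a m / real m)"
        using nonneg by (intro mult_right_mono) (auto intro: div_times_less_eq_dividend simp del: of_nat_mult)
      finally have "a n \<le> real n * (a m / real m) + C"
        using mult[of "n div m" m "n mod m"] C[of "n mod m"] m by simp
      then have "a n / real n \<le> a m / real m + C / real n"
        using n by (simp add: field_simps)
      moreover have "C / real n < e / 2"
      proof -
        have "2 * C / e < real n"
          using N n by linarith
        then show ?thesis
          using n \<open>e > 0\<close> by (simp add: field_simps)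
      qed
      ultimately have "a n / real n < L + e"
        using m by linarith
      then show "norm (a n / real n - L) < e"
        using lower[of n] n by simp
    qed
  qed
qed

section \<open>The operator norm: submultiplicativity, entries and continuity\<close>

lemma norm_matrix_vector_le_mat_norm: "norm (A *v v) \<le> mat_norm A * norm v"
  unfolding mat_norm_def by (rule onorm) simp

lemma mat_norm_mult_le: "mat_norm (A ** B) \<le> mat_norm A * mat_norm B"
proof -
  have "mat_norm (A ** B) = onorm ((\<lambda>v. A *v v) \<circ> (\<lambda>v. B *v v))"
    by (simp add: mat_norm_def o_def matrix_vector_mul_assoc)
  also have "\<dots> \<le> mat_norm A * mat_norm B"
    unfolding mat_norm_def by (rule onorm_compose) auto
  finally show ?thesis .
qed

lemma matrix_vector_mult_axis_component:
  fixes A :: "'a::semiring_1^'n^'m"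
  shows "(A *v axis j 1) $ i = A $ i $ j"
  by (simp add: matrix_vector_mult_def axis_def if_distrib sum.delta cong: if_cong)

lemma norm_column_le_mat_norm: "norm (A *v axis j 1) \<le> mat_norm A"
  using norm_matrix_vector_le_mat_norm[of A "axis j 1"] by simp

lemma norm_entry_le_mat_norm: "cmod (A $ i $ j) \<le> mat_norm A"
  using Finite_Cartesian_Product.norm_nth_le[of "A *v axis j 1" i] norm_column_le_mat_norm[of A j]
  by (simp add: matrix_vector_mult_axis_component)

text \<open>Each of the two components of \<open>A *v v\<close> is at most
  \<open>2 * norm A * norm v\<close>. The crude constant is enough to make \<open>mat_norm\<close>
  Lipschitz, hence continuous.\<close>

lemma mat_norm_le_norm: "mat_norm A \<le> 4 * norm A"
  unfolding mat_norm_def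
proof (rule onorm_le)
  fix v
  have entry: "cmod (A $ i $ j * v $ j) \<le> norm A * norm v" for i j
    unfolding norm_mult
    using Finite_Cartesian_Product.norm_nth_le[where x = "A $ i"]
      Finite_Cartesian_Product.norm_nth_le[where x = A] Finite_Cartesian_Product.norm_nth_le[where x = v]
    by (intro mult_mono) (auto intro: order.trans)
  have row: "cmod ((A *v v) $ i) \<le> 2 * (norm A * norm v)" for i
    using norm_triangle_ineq[of "A $ i $ 1 * v $ 1" "A $ i $ 2 * v $ 2"] entry[of i 1] entry[of i 2]
    by (simp add: matrix_vector_mult_def sum_2)
  have "norm (A *v v) \<le> (\<Sum>i\<in>UNIV. cmod ((A *v v) $ i))"
    unfolding norm_vec_def by (rule L2_set_le_sum) simp
  also have "\<dots> \<le> 4 * norm A * norm v"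
    using row[of 1] row[of 2] by (simp add: sum_2)
  finally show "norm (A *v v) \<le> 4 * norm A * norm v" .
qed

lemma mat_norm_diff_le: "\<bar>mat_norm A - mat_norm B\<bar> \<le> mat_norm (A - B)"
proof -
  have tri: "mat_norm A \<le> mat_norm B + mat_norm (A - B)" for A B
  proof -
    have "(\<lambda>v. B *v v + (A - B) *v v) = (\<lambda>v. A *v v)"
      by (simp flip: matrix_vector_mult_add_rdistrib)
    then show ?thesis
      using onorm_triangle[OF matrix_vector_mul_bounded_linear matrix_vector_mul_bounded_linear, of B "A - B"]
      by (simp only: mat_norm_def)
  qed
  have "mat_norm (B - A) = mat_norm (A - B)"
    using onorm_neg[of "\<lambda>v. (A - B) *v v"]
    by (simp add: mat_norm_def matrix_vector_mult_diff_rdistrib)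
  then show ?thesis
    using tri[of A B] tri[of B A] by linarith
qed

lemma continuous_on_mat_norm [continuous_intros]:
  assumes "continuous_on S A"
  shows "continuous_on S (\<lambda>x. mat_norm (A x))"
proof -
  have "\<bar>mat_norm A - mat_norm B\<bar> \<le> 4 * norm (A - B)" for A B
    using mat_norm_diff_le[of A B] mat_norm_le_norm[of "A - B"] by linarith
  then have "4-lipschitz_on UNIV mat_norm"
    by (intro lipschitz_onI) (auto simp: dist_norm)
  then have "continuous_on UNIV mat_norm"
    by (rule lipschitz_on_continuous_on)
  then show ?thesis
    using assms by (rule continuous_on_compose2) auto
qed

lemma continuous_on_matrix_entries:
  fixes A :: "'a::topological_space \<Rightarrow> 'b::topological_space^'n^'m"
  assumes "\<And>i j. continuous_on S (\<lambda>x. A x $ i $ j)"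
  shows "continuous_on S A"
proof -
  have "continuous_on S (\<lambda>x. \<chi> i j. A x $ i $ j)"
    by (intro continuous_on_vec_lambda assms)
  then show ?thesis by simp
qed

section \<open>Integrals over the circle and over the two-fibre space\<close>

text \<open>Rotation invariance of Lebesgue measure in the form used here: only the fractional part
  \<open>b\<close> of the shift matters, and the piece of the interval from \<open>b\<close> to
  \<open>1 + b\<close> beyond 1 is moved back by one period.\<close>

lemma integral_shift_periodic:
  fixes G :: "real \<Rightarrow> real"
  assumes cont: "continuous_on UNIV G" and per: "\<And>x n. G (x + of_int n) = G x"
  shows "integral {0..1} (\<lambda>t. G (t + a)) = integral {0..1} G"
proof -
  define b where "b = frac a"
  have b: "0 \<le> b" "b < 1"
    by (auto simp: b_def frac_lt_1)
  have int: "G integrable_on {x..y}" for x y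
    using cont continuous_on_subset integrable_continuous_real by blast
  have shift: "integral {x..y} (\<lambda>t. G (t + c)) = integral {x + c..y + c} G" for x y c
    using integral_shift[of x c y G] cont continuous_on_subset by (auto simp: o_def)
  have "G (t + a) = G (t + b)" for t
    using per[of "t + b" "\<lfloor>a\<rfloor>"] by (simp add: b_def frac_def)
  then have "integral {0..1} (\<lambda>t. G (t + a)) = integral {b..1 + b} G"
    using shift[of 0 1 b] by simp
  also have "\<dots> = integral {b..1} G + integral {1..1 + b} G"
    using b int by (intro Henstock_Kurzweil_Integration.integral_combine[symmetric]) auto
  also have "integral {1..1 + b} G = integral {0..b} G"
    using shift[of 0 b 1] per[of _ 1] by (simp add: add.commute)
  also have "integral {b..1} G + integral {0..b} G = integral {0..1} G"
    using b int Henstock_Kurzweil_Integration.integral_combine[of 0 b 1 G] by simp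
  finally show ?thesis .
qed

text \<open>Fubini, with weight one half on each fibre. Continuity up to the endpoint 1 supplies
  boundedness, and the extra endpoint is a null set.\<close>

lemma integral_Omega_measure:
  fixes F :: "real \<times> bit \<Rightarrow> real"
  assumes cont: "\<And>j. continuous_on {0..1} (\<lambda>t. F (t, j))"
  shows "(\<integral>\<omega>. F \<omega> \<partial>Omega_measure)
    = (integral {0..1} (\<lambda>t. F (t, 0)) + integral {0..1} (\<lambda>t. F (t, 1))) / 2"
proof -
  define M1 where "M1 = restrict_space lborel {0..<1::real}"
  define M2 where "M2 = uniform_count_measure {0, 1::bit}"
  interpret M1: finite_measure M1
    by (rule finite_measureI) (simp add: M1_def emeasure_restrict_space)
  interpret M2: finite_measure M2
    by (rule finite_measureI) (simp add: M2_def space_uniform_count_measure emeasure_uniform_count_measure)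
  interpret P: pair_sigma_finite M1 M2 ..
  interpret P: finite_measure "M1 \<Otimes>\<^sub>M M2"
    by (rule finite_measure_pair_measure) unfold_locales
  have sets1: "sets M1 = sets (restrict_space borel {0..<1})"
    by (simp add: M1_def sets_restrict_space)
  have [measurable]: "(\<lambda>t. F (t, j)) \<in> borel_measurable M1" for j
    unfolding measurable_cong_sets[OF sets1 refl]
    by (intro borel_measurable_continuous_on_restrict continuous_on_subset[OF cont]) auto
  have sets2 [measurable_cong]: "sets M2 = sets (count_space UNIV)"
    by (auto simp: M2_def sets_uniform_count_measure)
  \<comment> \<open>Joint measurability is obtained fibre by fibre, by writing \<open>F\<close> as a
    case distinction on the second coordinate.\<close>
  have "(\<lambda>x. if snd x = 0 then F (fst x, 0) else F (fst x, 1)) \<in> borel_measurable (M1 \<Otimes>\<^sub>M M2)"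
    by measurable
  also have "(\<lambda>x. if snd x = 0 then F (fst x, 0) else F (fst x, 1)) = F"
  proof
    fix x :: "real \<times> bit"
    show "(if snd x = 0 then F (fst x, 0) else F (fst x, 1)) = F x"
      by (cases x; cases "snd x") auto
  qed
  finally have meas: "F \<in> borel_measurable (M1 \<Otimes>\<^sub>M M2)" .
  have "bounded ((\<lambda>t. F (t, j)) ` {0..1})" for j
    by (intro compact_imp_bounded compact_continuous_image cont) auto
  then have "\<exists>B. \<forall>t\<in>{0..1}. \<bar>F (t, j)\<bar> \<le> B" for j
    unfolding bounded_iff by auto
  then obtain B where B: "\<And>t j. t \<in> {0..1} \<Longrightarrow> \<bar>F (t, j)\<bar> \<le> B j"
    by metis
  have "norm (F x) \<le> max (B 0) (B 1)" if "x \<in> space (M1 \<Otimes>\<^sub>M M2)" for x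
  proof (cases x)
    case (Pair t j)
    then have "t \<in> {0..1}"
      using that by (auto simp: space_pair_measure M1_def space_restrict_space)
    then show ?thesis
      using B[of t j] Pair by (cases j) (auto simp: le_max_iff_disj)
  qed
  then have int: "integrable (M1 \<Otimes>\<^sub>M M2) F"
    by (intro P.integrable_const_bound[where B = "max (B 0) (B 1)"] AE_I2 meas)
  have si: "set_integrable lborel {0..<1} (\<lambda>t. F (t, j))" for j
    by (rule set_integrable_subset[OF borel_integrable_atLeastAtMost'[OF cont]]) auto
  have half: "(\<integral>t. F (t, j) \<partial>M1) = integral {0..1} (\<lambda>t. F (t, j))" for j
  proof -
    have "(\<integral>t. F (t, j) \<partial>M1) = (LINT t:{0..<1}|lborel. F (t, j))"
      by (simp add: M1_def integral_restrict_space set_lebesgue_integral_def)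
    also have "\<dots> = integral {0..<1} (\<lambda>t. F (t, j))"
      by (rule set_borel_integral_eq_integral[OF si])
    also have "\<dots> = integral {0..1} (\<lambda>t. F (t, j))"
    proof (rule integral_spike_set)
      show "negligible {t \<in> {0..<1} - {0..1}. F (t, j) \<noteq> 0}"
        by (rule negligible_subset[of "{}"]) auto
      show "negligible {t \<in> {0..1} - {0..<1}. F (t, j) \<noteq> 0}"
        by (rule negligible_subset[of "{1}"]) auto
    qed
    finally show ?thesis .
  qed
  have i1: "integrable M1 (\<lambda>t. F (t, j))" for j
    using si[of j] by (simp add: M1_def integrable_restrict_space set_integrable_def)
  have "(\<integral>\<omega>. F \<omega> \<partial>Omega_measure) = (\<integral>t. (\<integral>j. F (t, j) \<partial>M2) \<partial>M1)"
    unfolding Omega_measure_def M1_def[symmetric] M2_def[symmetric] by (rule P.integral_fst'[OF int, symmetric])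
  also have "\<dots> = (\<integral>t. (F (t, 0) + F (t, 1)) / 2 \<partial>M1)"
    by (simp add: M2_def integral_uniform_count_measure)
  also have "\<dots> = ((\<integral>t. F (t, 0) \<partial>M1) + (\<integral>t. F (t, 1) \<partial>M1)) / 2"
    using i1 by simp
  finally show ?thesis
    by (simp add: half)
qed

subsection \<open>The cocycle\<close>

definition fourier_mode :: "int \<Rightarrow> real \<Rightarrow> complex" where
  "fourier_mode k t = exp (2 * pi * \<i> * of_int k * of_real t)"

lemma fourier_mode_add: "fourier_mode k (s + t) = fourier_mode k s * fourier_mode k t"
  by (simp add: fourier_mode_def exp_add[symmetric] algebra_simps)

lemma fourier_mode_uminus: "fourier_mode (- k) t = inverse (fourier_mode k t)"
  by (simp add: fourier_mode_def exp_minus[symmetric])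

lemma norm_fourier_mode [simp]: "cmod (fourier_mode k t) = 1"
  by (simp add: fourier_mode_def)

lemma fourier_mode_nonzero [simp]: "fourier_mode k t \<noteq> 0"
  by (simp add: fourier_mode_def)

lemma cnj_fourier_mode: "cnj (fourier_mode k t) = inverse (fourier_mode k t)"
  by (simp add: fourier_mode_def exp_cnj exp_minus[symmetric])

lemma fourier_mode_of_int [simp]: "fourier_mode k (of_int m) = 1"
  using exp_integer_2pi[of "of_int (k * m)"] by (simp add: fourier_mode_def mult_ac)

lemma continuous_on_fourier_mode [continuous_intros]: "continuous_on S (fourier_mode k)"
  unfolding fourier_mode_def by (intro continuous_intros)

lemma cocycle_iterate_add:
  "cocycle_iterate A T (m + n) \<omega> = cocycle_iterate A T m ((T ^^ n) \<omega>) ** cocycle_iterate A T n \<omega>"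
  by (induction m) (simp_all add: funpow_add matrix_mul_assoc)

text \<open>The integers removed by \<open>frac\<close> along the orbit are collected in an
  unspecified \<open>m\<close>, which disappears once a function of period 1 is applied.\<close>

lemma rotation_flip_iterate:
  "\<exists>m. (rotation_flip \<alpha> ^^ n) (\<theta>, j) = (\<theta> + real n * \<alpha> - of_int m, j + of_nat n)"
proof (induction n)
  case (Suc n)
  then obtain m where m: "(rotation_flip \<alpha> ^^ n) (\<theta>, j) = (\<theta> + real n * \<alpha> - of_int m, j + of_nat n)"
    by blast
  define x where "x = \<theta> + real n * \<alpha> - of_int m + \<alpha>"
  have "(rotation_flip \<alpha> ^^ Suc n) (\<theta>, j) = (x - of_int \<lfloor>x\<rfloor>, j + of_nat n + 1)"
    using m by (simp add: rotation_flip_def x_def frac_def)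
  also have "\<dots> = (\<theta> + real (Suc n) * \<alpha> - of_int (m + \<lfloor>x\<rfloor>), j + of_nat (Suc n))"
    by (simp add: x_def algebra_simps)
  finally show ?case by blast
qed (auto intro: exI[of _ 0])

lemma verblunsky_fun_fourier_mode:
  "verblunsky_fun \<epsilon> k (\<theta>, j)
    = of_real (sqrt (1 - \<epsilon>\<^sup>2)) * fourier_mode (if j = 0 then k else - k) \<theta>"
  by (simp add: verblunsky_fun_def fourier_mode_def)

section \<open>The Szego cocycle at a fixed spectral parameter\<close>

locale szego_rotation =
  fixes \<alpha> \<epsilon> :: real and k :: int and z :: complex
  assumes eps: "0 < \<epsilon>" "\<epsilon> < 1" and k_nonzero: "k \<noteq> 0" and z_unit: "cmod z = 1"
begin

definition r :: real where "r = sqrt (1 - \<epsilon>\<^sup>2)"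

definition freq :: "bit \<Rightarrow> int" where "freq j = (if j = 0 then k else - k)"

definition F :: "real \<times> bit \<Rightarrow> complex" where "F = verblunsky_fun \<epsilon> k"

definition A :: "real \<times> bit \<Rightarrow> complex^2^2" where "A = szego_matrix F z"

definition C :: "nat \<Rightarrow> real \<times> bit \<Rightarrow> complex^2^2" where
  "C = cocycle_iterate A (rotation_flip \<alpha>)"

lemma eps_square: "\<epsilon>\<^sup>2 < 1"
  using eps by (simp add: power_less_one_iff abs_square_less_1)

lemma r_pos: "0 < r"
  using eps_square by (simp add: r_def)

lemma r_square: "r\<^sup>2 = 1 - \<epsilon>\<^sup>2"
  using eps_square by (simp add: r_def)

lemma F_eq: "F (\<theta>, j) = of_real r * fourier_mode (freq j) \<theta>"
  by (simp add: F_def verblunsky_fun_fourier_mode freq_def r_def)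

lemma cmod_F: "cmod (F \<omega>) = r"
  using r_pos by (cases \<omega>) (simp add: F_eq norm_mult)

lemma freq_add_1: "freq (j + 1) = - freq j"
  by (cases j) (auto simp: freq_def)

text \<open>The normalising factor is \<open>1 / \<epsilon>\<close> on the whole space, because
  \<open>F\<close> has constant modulus \<open>r\<close> and
  \<open>1 - r\<^sup>2 = \<epsilon>\<^sup>2\<close>.\<close>

lemma A_entries:
  "A \<omega> $ 1 $ 1 = z / \<epsilon>" "A \<omega> $ 1 $ 2 = - cnj (F \<omega>) / \<epsilon>"
  "A \<omega> $ 2 $ 1 = - F \<omega> * z / \<epsilon>" "A \<omega> $ 2 $ 2 = 1 / \<epsilon>"
  using eps by (simp_all add: A_def szego_matrix_def cmod_F r_square Let_def)

lemma A_periodic: "A (\<theta> + of_int m, j) = A (\<theta>, j)"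
  by (simp add: A_def szego_matrix_def F_eq fourier_mode_add)

lemma C_0: "C 0 \<omega> = mat 1"
  by (simp add: C_def)

text \<open>Periodicity of \<open>A\<close> allows the reduction modulo 1 to be dropped, so the
  orbit becomes a plain translation on the real line.\<close>

lemma C_Suc: "C (Suc n) (\<theta>, j) = A (\<theta> + real n * \<alpha>, j + of_nat n) ** C n (\<theta>, j)"
proof -
  obtain m where "(rotation_flip \<alpha> ^^ n) (\<theta>, j) = (\<theta> + real n * \<alpha> - of_int m, j + of_nat n)"
    using rotation_flip_iterate by blast
  then show ?thesis
    using A_periodic[of "\<theta> + real n * \<alpha> - of_int m" m "j + of_nat n"] by (simp add: C_def)
qed

lemma C_periodic: "C n (\<theta> + of_int m, j) = C n (\<theta>, j)"
proof (induction n)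
  case (Suc n)
  then show ?case
    using A_periodic[of "\<theta> + real n * \<alpha>" m "j + of_nat n"] by (simp add: C_Suc ac_simps)
qed (simp add: C_0)

lemma C_add: "C (m + n) (\<theta>, j) = C m (\<theta> + real n * \<alpha>, j + of_nat n) ** C n (\<theta>, j)"
proof -
  obtain q where "(rotation_flip \<alpha> ^^ n) (\<theta>, j) = (\<theta> + real n * \<alpha> - of_int q, j + of_nat n)"
    using rotation_flip_iterate by blast
  then show ?thesis
    using C_periodic[of m "\<theta> + real n * \<alpha> - of_int q" q "j + of_nat n"]
    by (simp add: C_def cocycle_iterate_add)
qed

lemma continuous_on_F: "continuous_on S (\<lambda>t. F (t + c, j))"
  unfolding F_eq fourier_mode_add by (intro continuous_intros)

lemma continuous_on_A_entry: "continuous_on S (\<lambda>t. A (t + c, j) $ i $ l)"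
proof -
  have "continuous_on S (\<lambda>t. A (t + c, j) $ i $ l)"
    if "i = 1 \<or> i = 2" "l = 1 \<or> l = 2" for i l :: 2
    using that eps
    by (elim disjE) (simp_all only: A_entries, (intro continuous_intros continuous_on_F; simp)+)
  then show ?thesis
    using exhaust_2 by blast
qed

lemma continuous_on_C: "continuous_on S (\<lambda>t. C n (t, j))"
proof (rule continuous_on_matrix_entries)
  show "continuous_on S (\<lambda>t. C n (t, j) $ i $ l)" for i l
  proof (induction n arbitrary: i l)
    case (Suc n)
    show ?case
      unfolding C_Suc matrix_matrix_mult_def
      by (simp only: vec_lambda_beta sum_2) (intro continuous_intros continuous_on_A_entry Suc.IH)
  qed (simp add: C_0)
qed

section \<open>The invariant indefinite form and nonnegativity of the log-norm\<close>

text \<open>The matrices belong to U(1,1). Before normalisation the cross terms cancel and the form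
  is multiplied by \<open>1 - f * cnj f\<close>, that is by the square of \<epsilon>; the factor
  \<open>1 / \<epsilon>\<close> undoes this.\<close>

lemma A_preserves_form:
  "(cmod ((A \<omega> *v v) $ 1))\<^sup>2 - (cmod ((A \<omega> *v v) $ 2))\<^sup>2 = (cmod (v $ 1))\<^sup>2 - (cmod (v $ 2))\<^sup>2"
proof -
  define f where "f = F \<omega>"
  define a where "a = v $ 1"
  define b where "b = v $ 2"
  have z: "z * cnj z = 1"
    using z_unit by (simp add: complex_norm_square[symmetric])
  have f: "f * cnj f = 1 - (of_real \<epsilon>)\<^sup>2"
    using cmod_F[of \<omega>] r_square by (simp add: f_def complex_norm_square[symmetric] flip: of_real_power)
  have e: "complex_of_real \<epsilon> \<noteq> 0"
    using eps by simp
  have "(z * a - cnj f * b) * (cnj z * cnj a - f * cnj b)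
      - (b - f * z * a) * (cnj b - cnj f * cnj z * cnj a)
      = (1 - f * cnj f) * (z * cnj z * a * cnj a - b * cnj b)"
    by (simp add: algebra_simps)
  also have "\<dots> = (of_real \<epsilon>)\<^sup>2 * (a * cnj a - b * cnj b)"
    by (simp add: z f)
  finally have form: "(z * a - cnj f * b) * cnj (z * a - cnj f * b) - (b - f * z * a) * cnj (b - f * z * a)
      = (of_real \<epsilon>)\<^sup>2 * (a * cnj a - b * cnj b)"
    by simp
  have "complex_of_real ((cmod (z * a - cnj f * b))\<^sup>2 - (cmod (b - f * z * a))\<^sup>2)
      = complex_of_real (\<epsilon>\<^sup>2 * ((cmod a)\<^sup>2 - (cmod b)\<^sup>2))"
    by (simp only: of_real_diff of_real_mult complex_norm_square form of_real_power[of \<epsilon>])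
  then have real_form: "(cmod (z * a - cnj f * b))\<^sup>2 - (cmod (b - f * z * a))\<^sup>2
      = \<epsilon>\<^sup>2 * ((cmod a)\<^sup>2 - (cmod b)\<^sup>2)"
    by (simp only: of_real_eq_iff)
  have "(A \<omega> *v v) $ 1 = (z * a - cnj f * b) / \<epsilon>" "(A \<omega> *v v) $ 2 = (b - f * z * a) / \<epsilon>"
    by (simp_all add: matrix_vector_mult_def sum_2 A_entries f_def a_def b_def diff_divide_distrib)
  then have "(cmod ((A \<omega> *v v) $ 1))\<^sup>2 - (cmod ((A \<omega> *v v) $ 2))\<^sup>2
      = ((cmod (z * a - cnj f * b))\<^sup>2 - (cmod (b - f * z * a))\<^sup>2) / \<epsilon>\<^sup>2"
    by (simp only: norm_divide power_divide norm_of_real power2_abs) (simp add: diff_divide_distrib)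
  then show ?thesis
    using eps unfolding real_form a_def[symmetric] b_def[symmetric] by simp
qed

text \<open>The form takes the value 1 on the first basis vector and is preserved, so the first
  component of its image has modulus at least 1. This yields the nonnegativity required by both the
  Jensen and the Fekete arguments.\<close>

lemma mat_norm_C_ge_1: "1 \<le> mat_norm (C n (\<theta>, j))"
proof -
  define v :: "complex^2" where "v = axis 1 1"
  have "(cmod ((C n (\<theta>, j) *v v) $ 1))\<^sup>2 - (cmod ((C n (\<theta>, j) *v v) $ 2))\<^sup>2 = 1"
  proof (induction n)
    case 0
    show ?case by (simp add: C_0 v_def axis_def)
  next
    case (Suc n)
    then show ?case
      by (simp add: C_Suc A_preserves_form flip: matrix_vector_mul_assoc)
  qed
  then have "1 \<le> (cmod ((C n (\<theta>, j) *v v) $ 1))\<^sup>2"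
    using zero_le_power2[of "cmod ((C n (\<theta>, j) *v v) $ 2)"] by linarith
  then have "1 \<le> cmod ((C n (\<theta>, j) *v v) $ 1)"
    using abs_square_less_1[of "cmod ((C n (\<theta>, j) *v v) $ 1)"] by (simp add: not_less[symmetric])
  also have "\<dots> \<le> norm (C n (\<theta>, j) *v v)"
    by (rule Finite_Cartesian_Product.norm_nth_le)
  also have "\<dots> \<le> mat_norm (C n (\<theta>, j))"
    unfolding v_def by (rule norm_column_le_mat_norm)
  finally show ?thesis .
qed

section \<open>Subadditivity of the integrated log-norm\<close>

definition u :: "nat \<Rightarrow> bit \<Rightarrow> real \<Rightarrow> real" where
  "u n j t = ln (mat_norm (C n (t, j)))"

lemma mat_norm_C_pos: "0 < mat_norm (C n (t, j))"
  using mat_norm_C_ge_1[of n t j] by linarith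

lemma u_nonneg: "0 \<le> u n j t"
  using mat_norm_C_ge_1 by (simp add: u_def)

lemma exp_u: "exp (u n j t) = mat_norm (C n (t, j))"
  using mat_norm_C_pos by (simp add: u_def)

lemma continuous_on_u: "continuous_on S (u n j)"
  unfolding u_def using mat_norm_C_pos
  by (intro continuous_intros continuous_on_C) (metis less_irrefl)

lemma u_periodic: "u n j (t + of_int m) = u n j t"
  by (simp add: u_def C_periodic)

lemma u_add_le: "u (m + n) j t \<le> u m (j + of_nat n) (t + real n * \<alpha>) + u n j t"
proof -
  have "u (m + n) j t \<le> ln (mat_norm (C m (t + real n * \<alpha>, j + of_nat n)) * mat_norm (C n (t, j)))"
    unfolding u_def C_add[of m n] using mat_norm_C_pos[of "m + n" t j, unfolded C_add]
    by (rule ln_mono[OF mat_norm_mult_le])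
  also have "\<dots> = u m (j + of_nat n) (t + real n * \<alpha>) + u n j t"
    unfolding u_def by (rule ln_mult_pos[OF mat_norm_C_pos mat_norm_C_pos])
  finally show ?thesis .
qed

definition a :: "nat \<Rightarrow> real" where
  "a n = (\<integral>\<omega>. ln (mat_norm (C n \<omega>)) \<partial>Omega_measure)"

lemma a_eq: "a n = (integral {0..1} (u n 0) + integral {0..1} (u n 1)) / 2"
  unfolding a_def using integral_Omega_measure[of "\<lambda>\<omega>. ln (mat_norm (C n \<omega>))"] continuous_on_u
  by (simp add: u_def[abs_def])

lemma a_nonneg: "0 \<le> a n"
  unfolding a_eq by (simp add: integral_nonneg u_nonneg integrable_continuous_real continuous_on_u)

text \<open>Integrate \<open>u_add_le\<close> and use that the base map preserves the measure:
  translating the angle keeps each integral over a period, and adding \<open>of_nat n\<close> to the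
  fibre index fixes or swaps the two fibres, so their sum is unchanged.\<close>

lemma a_add_le: "a (m + n) \<le> a m + a n"
proof -
  have le: "integral {0..1} (u (m + n) j) \<le> integral {0..1} (u m (j + of_nat n)) + integral {0..1} (u n j)" for j
  proof -
    have int: "u n j integrable_on {0..1}" for n j
      by (intro integrable_continuous_real continuous_on_u)
    have "continuous_on {0..1} (\<lambda>t. u m (j + of_nat n) (t + real n * \<alpha>))"
      by (rule continuous_on_compose2[OF continuous_on_u[of UNIV]]) (auto intro!: continuous_intros)
    then have int': "(\<lambda>t. u m (j + of_nat n) (t + real n * \<alpha>)) integrable_on {0..1}"
      by (rule integrable_continuous_real)
    have "integral {0..1} (u (m + n) j)
        \<le> integral {0..1} (\<lambda>t. u m (j + of_nat n) (t + real n * \<alpha>) + u n j t)"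
      by (intro integral_le int integrable_add int' u_add_le)
    also have "\<dots> = integral {0..1} (\<lambda>t. u m (j + of_nat n) (t + real n * \<alpha>)) + integral {0..1} (u n j)"
      by (intro integral_add int int')
    also have "integral {0..1} (\<lambda>t. u m (j + of_nat n) (t + real n * \<alpha>)) = integral {0..1} (u m (j + of_nat n))"
      by (intro integral_shift_periodic continuous_on_u u_periodic)
    finally show ?thesis .
  qed
  define I where "I = (\<lambda>n j. integral {0..1} (u n j))"
  have "I m (of_nat n) + I m (1 + of_nat n) = I m 0 + I m 1"
    by (cases "of_nat n :: bit") auto
  moreover have "I (m + n) 0 \<le> I m (of_nat n) + I n 0" "I (m + n) 1 \<le> I m (1 + of_nat n) + I n 1"
    using le[of 0] le[of 1] by (simp_all only: I_def add_0)
  ultimately have "(I (m + n) 0 + I (m + n) 1) / 2 \<le> (I m 0 + I m 1) / 2 + (I n 0 + I n 1) / 2"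
    by argo
  then show ?thesis
    by (simp only: I_def a_eq)
qed

text \<open>The exponent is defined through \<open>lim\<close>, which is informative only once
  convergence is known; Fekete's lemma provides it.\<close>

lemma szego_lyapunov_limit: "(\<lambda>n. a n / real n) \<longlonglongrightarrow> szego_lyapunov \<alpha> \<epsilon> k z"
proof -
  have "convergent (\<lambda>n. a n / real n)"
    using fekete_nonneg[of a] a_add_le a_nonneg convergentI by blast
  then have "(\<lambda>n. a n / real n) \<longlonglongrightarrow> lim (\<lambda>n. a n / real n)"
    by (simp add: convergent_LIMSEQ_iff)
  then show ?thesis
    by (simp add: szego_lyapunov_def lyapunov_exponent_def a_def C_def A_def F_def)
qed

section \<open>Herman's polynomials and the lower bound\<close>

text \<open>Consecutive fibres carry \<open>w\<close> and its inverse, so the entries of the product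
  involve powers of \<open>w\<close> from -2 to 2. The power -2 occurs only in the lower right
  entry, which alone survives at 0 after multiplication by the square of \<open>w\<close>.\<close>

lemma two_step_polynomials:
  obtains p11 p12 p21 p22 where
    "\<And>t. let w = fourier_mode (freq j) t; B = A (t + (c + \<alpha>), j + 1) ** A (t + c, j) in
      w\<^sup>2 * B $ 1 $ 1 = poly p11 w \<and> w\<^sup>2 * B $ 1 $ 2 = poly p12 w \<and>
      w\<^sup>2 * B $ 2 $ 1 = poly p21 w \<and> w\<^sup>2 * B $ 2 $ 2 = poly p22 w"
    "poly p21 0 = 0" "cmod (poly p22 0) = (r / \<epsilon>)\<^sup>2"
proof
  \<comment> \<open>The unimodular phases \<open>x\<close> and \<open>y\<close> absorb the angles of
    the first and second step, the latter with reversed frequency.\<close>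
  define x where "x = fourier_mode (freq j) c"
  define y where "y = fourier_mode (- freq j) (c + \<alpha>)"
  let ?R = "complex_of_real r" and ?E = "complex_of_real \<epsilon>"
  let ?p11 = "[:0, 0, z\<^sup>2 / ?E\<^sup>2, 0, ?R\<^sup>2 * x * inverse y * z / ?E\<^sup>2:]"
  let ?p12 = "[:0, - ?R * z * inverse x / ?E\<^sup>2, 0, - ?R * inverse y / ?E\<^sup>2:]"
  let ?p21 = "[:0, - ?R * y * z\<^sup>2 / ?E\<^sup>2, 0, - ?R * x * z / ?E\<^sup>2:]"
  let ?p22 = "[:?R\<^sup>2 * y * inverse x * z / ?E\<^sup>2, 0, 1 / ?E\<^sup>2:]"
  show "let w = fourier_mode (freq j) t; B = A (t + (c + \<alpha>), j + 1) ** A (t + c, j) in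
      w\<^sup>2 * B $ 1 $ 1 = poly ?p11 w \<and> w\<^sup>2 * B $ 1 $ 2 = poly ?p12 w \<and>
      w\<^sup>2 * B $ 2 $ 1 = poly ?p21 w \<and> w\<^sup>2 * B $ 2 $ 2 = poly ?p22 w" for t
  proof -
    define w where "w = fourier_mode (freq j) t"
    have nz: "w \<noteq> 0" "x \<noteq> 0" "y \<noteq> 0" "?E \<noteq> 0"
      using eps by (simp_all add: w_def x_def y_def)
    have cnj: "cnj w = inverse w" "cnj x = inverse x" "cnj y = inverse y"
      by (simp_all add: w_def x_def y_def cnj_fourier_mode)
    have F: "F (t + c, j) = ?R * (w * x)" "F (t + (c + \<alpha>), j + 1) = ?R * (inverse w * y)"
      unfolding F_eq freq_add_1 fourier_mode_add[of _ t] w_def x_def y_def fourier_mode_uminus[of _ t]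
      by simp_all
    show ?thesis
      unfolding Let_def w_def[symmetric]
      unfolding matrix_matrix_mult_def vec_lambda_beta sum_2 A_entries F
      using nz by (simp add: cnj field_simps power2_eq_square)
  qed
  show "poly ?p21 0 = 0" by simp
  show "cmod (poly ?p22 0) = (r / \<epsilon>)\<^sup>2"
    using eps r_pos z_unit
    by (simp add: norm_mult norm_divide norm_power norm_inverse x_def y_def power_divide)
qed

text \<open>Left multiplication by a two-step matrix acts on the second column alone, so only that
  column is tracked. As \<open>p21\<close> vanishes at 0, the upper entry does not contribute to the
  constant term of the lower one, which is therefore multiplicative in modulus.\<close>

lemma iterate_polynomials:
  "\<exists>p q. (\<forall>t. fourier_mode (freq j) t ^ (2 * n) * C (2 * n) (t, j) $ 1 $ 2 = poly p (fourier_mode (freq j) t) \<and>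
      fourier_mode (freq j) t ^ (2 * n) * C (2 * n) (t, j) $ 2 $ 2 = poly q (fourier_mode (freq j) t)) \<and>
    cmod (poly q 0) = (r / \<epsilon>) ^ (2 * n)"
proof (induction n)
  case 0
  show ?case
    by (intro exI[of _ 0] exI[of _ 1]) (simp add: C_0 mat_def)
next
  case (Suc n)
  then obtain p q where pq:
    "\<And>t. fourier_mode (freq j) t ^ (2 * n) * C (2 * n) (t, j) $ 1 $ 2 = poly p (fourier_mode (freq j) t)"
    "\<And>t. fourier_mode (freq j) t ^ (2 * n) * C (2 * n) (t, j) $ 2 $ 2 = poly q (fourier_mode (freq j) t)"
    "cmod (poly q 0) = (r / \<epsilon>) ^ (2 * n)"
    by blast
  define c where "c = real (2 * n) * \<alpha>"
  define B where "B = (\<lambda>t. A (t + (c + \<alpha>), j + 1) ** A (t + c, j))"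
  obtain p11 p12 p21 p22 where P:
    "\<And>t. let w = fourier_mode (freq j) t in
      w\<^sup>2 * B t $ 1 $ 1 = poly p11 w \<and> w\<^sup>2 * B t $ 1 $ 2 = poly p12 w \<and>
      w\<^sup>2 * B t $ 2 $ 1 = poly p21 w \<and> w\<^sup>2 * B t $ 2 $ 2 = poly p22 w"
    "poly p21 0 = 0" "cmod (poly p22 0) = (r / \<epsilon>)\<^sup>2"
    using two_step_polynomials[of j c] unfolding B_def Let_def by blast
  have step: "C (2 * Suc n) (t, j) = B t ** C (2 * n) (t, j)" for t
  proof -
    \<comment> \<open>After an even number of steps the orbit is back on the fibre \<open>j\<close>,
      so the same variable \<open>w\<close> serves for every two-step block.\<close>
    have even: "of_nat (2 * n) = (0::bit)" "of_nat (Suc (2 * n)) = (1::bit)"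
      by simp_all
    have "C (2 * Suc n) (t, j) = A (t + real (Suc (2 * n)) * \<alpha>, j + of_nat (Suc (2 * n))) **
        (A (t + real (2 * n) * \<alpha>, j + of_nat (2 * n)) ** C (2 * n) (t, j))"
      using C_Suc[of "Suc (2 * n)" t j] C_Suc[of "2 * n" t j] by simp
    also have "\<dots> = B t ** C (2 * n) (t, j)"
      unfolding even by (simp add: B_def c_def matrix_mul_assoc algebra_simps)
    finally show ?thesis .
  qed
  show ?case
  proof (intro exI conjI allI)
    fix t
    let ?w = "fourier_mode (freq j) t"
    have "?w ^ (2 * Suc n) * C (2 * Suc n) (t, j) $ i $ 2
        = (?w\<^sup>2 * B t $ i $ 1) * (?w ^ (2 * n) * C (2 * n) (t, j) $ 1 $ 2)
        + (?w\<^sup>2 * B t $ i $ 2) * (?w ^ (2 * n) * C (2 * n) (t, j) $ 2 $ 2)" for i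
      unfolding step by (simp add: matrix_matrix_mult_def sum_2 algebra_simps power_add power2_eq_square)
    note entry = this[unfolded pq]
    show "?w ^ (2 * Suc n) * C (2 * Suc n) (t, j) $ 1 $ 2 = poly (p11 * p + p12 * q) ?w"
      "?w ^ (2 * Suc n) * C (2 * Suc n) (t, j) $ 2 $ 2 = poly (p21 * p + p22 * q) ?w"
      unfolding entry using P(1)[of t] by (simp_all add: Let_def)
  next
    show "cmod (poly (p21 * p + p22 * q) 0) = (r / \<epsilon>) ^ (2 * Suc n)"
      using P(2,3) pq(3) by (simp add: norm_mult power_add power2_eq_square)
  qed
qed

text \<open>Multiplying by a power of the unimodular \<open>w\<close> does not change the modulus,
  so \<open>q\<close> on the circle is bounded by the norm of the cocycle; Jensen's inequality then
  evaluates the constant term.\<close>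

lemma integral_u_ge: "real (2 * n) * ln (r / \<epsilon>) \<le> integral {0..1} (u (2 * n) j)"
proof -
  obtain p q where q: "cmod (poly q 0) = (r / \<epsilon>) ^ (2 * n)"
    "\<And>t. fourier_mode (freq j) t ^ (2 * n) * C (2 * n) (t, j) $ 2 $ 2 = poly q (fourier_mode (freq j) t)"
    using iterate_polynomials[of j n] by blast
  have pos: "0 < r / \<epsilon>"
    using r_pos eps by simp
  have "cmod (poly q (fourier_mode (freq j) t)) \<le> exp (u (2 * n) j t)" for t
    unfolding q(2)[symmetric] by (simp add: norm_mult norm_power exp_u norm_entry_le_mat_norm)
  then have "ln (cmod (poly q 0)) \<le> integral {0..1} (u (2 * n) j)"
    using k_nonzero pos q(1)
    by (intro jensen_frequency[of "freq j"] continuous_on_u u_nonneg)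
      (auto simp: fourier_mode_def freq_def simp del: norm_eq_zero simp flip: norm_eq_zero[of "poly q 0"])
  then show ?thesis
    using pos by (simp only: q(1) ln_realpow)
qed

text \<open>Even times suffice because the full sequence converges, and both fibres satisfy the same
  bound, so it survives averaging.\<close>

lemma szego_lyapunov_ge: "ln (r / \<epsilon>) \<le> szego_lyapunov \<alpha> \<epsilon> k z"
proof (rule LIMSEQ_le_const)
  show "(\<lambda>n. a (2 * n) / real (2 * n)) \<longlonglongrightarrow> szego_lyapunov \<alpha> \<epsilon> k z"
    using LIMSEQ_subseq_LIMSEQ[OF szego_lyapunov_limit, of "\<lambda>n. 2 * n"]
    by (simp add: o_def strict_mono_def)
  show "\<exists>N. \<forall>n\<ge>N. ln (r / \<epsilon>) \<le> a (2 * n) / real (2 * n)"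
  \<comment> \<open>Starting at 1 avoids the index 0, where the quotient is 0 by convention and the
    bound fails if the logarithm is positive.\<close>
  proof (intro exI[of _ 1] allI impI)
    fix n :: nat assume "n \<ge> 1"
    then show "ln (r / \<epsilon>) \<le> a (2 * n) / real (2 * n)"
      using integral_u_ge[of n 0] integral_u_ge[of n 1] by (simp add: a_eq field_simps)
  qed
qed

end

theorem theorem1:
  fixes \<alpha> \<epsilon> :: real and k :: int
  assumes "\<alpha> \<notin> \<rat>" and "0 < \<epsilon>" and "\<epsilon> < 1" and "k \<noteq> 0"
  shows "(INF z\<in>sphere (0::complex) 1. szego_lyapunov \<alpha> \<epsilon> k z) \<ge> ln (sqrt (1 - \<epsilon>\<^sup>2) / \<epsilon>)
    \<and> (\<epsilon> < 1 / sqrt 2 \<longrightarrow> (INF z\<in>sphere (0::complex) 1. szego_lyapunov \<alpha> \<epsilon> k z) > 0)"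
proof -
  have "ln (sqrt (1 - \<epsilon>\<^sup>2) / \<epsilon>) \<le> szego_lyapunov \<alpha> \<epsilon> k z" if "z \<in> sphere 0 1" for z
  proof -
    interpret szego_rotation \<alpha> \<epsilon> k z
      using assms that by unfold_locales auto
    show ?thesis
      using szego_lyapunov_ge by (simp add: r_def)
  qed
  \<comment> \<open>The bound is independent of \<open>z\<close>, so it passes to the infimum over
    the nonempty circle.\<close>
  then have bound: "ln (sqrt (1 - \<epsilon>\<^sup>2) / \<epsilon>) \<le> (INF z\<in>sphere (0::complex) 1. szego_lyapunov \<alpha> \<epsilon> k z)"
    by (intro cINF_greatest) auto
  moreover have "0 < ln (sqrt (1 - \<epsilon>\<^sup>2) / \<epsilon>)" if "\<epsilon> < 1 / sqrt 2"
  proof -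
    have "\<epsilon>\<^sup>2 < (1 / sqrt 2)\<^sup>2"
      using that assms by (intro power_strict_mono) auto
    \<comment> \<open>The threshold \<open>1 / sqrt 2\<close> is exactly where the squares of
      \<epsilon> and \<open>sqrt (1 - \<epsilon>\<^sup>2)\<close> coincide.\<close>
    then have "\<epsilon>\<^sup>2 < 1 - \<epsilon>\<^sup>2"
      by (simp add: power_divide)
    then have "\<epsilon> < sqrt (1 - \<epsilon>\<^sup>2)"
      using assms by (intro real_less_rsqrt)
    then show ?thesis
      using assms(2) by (intro ln_gt_zero) simp
  qed
  ultimately show ?thesis
    by fastforce
qed

end
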